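(* Fix integers $t \geq 3$ and $n_1, n_2$ with $n_2 \geq n_1 \geq 1$, put $n = n_1 + n_2$, and let $\gamma \leq \dfrac{n_1/n_2}{t^3}$. Let $G$ be a bipartite graph with parts $X_1, X_2$, where $|X_1| = n_1$ and $|X_2| = n_2$, such that every $x \in X_1$ has degree $d(x) \geq (1-\gamma)n_2$ and every $y \in X_2$ has degree $d(y) \geq (1-\gamma)n_1$. Then every coloring of the edges of $G$ with $t$ colors contains a monochromatic connected component with at least $n/t$ vertices.
   Context: A monochromatic component of an edge-colored graph is a connected component of the spanning subgraph formed by the edges of a single color. Its order is its number of vertices. *)

theory Defs
  imports Complex_Main "Graph_Theory.Digraph_Component"
begin

text \<open>
  A finite simple graph is a \<^locale>\<open>pair_graph\<close>: a finite, loop-free, symmetric digraph.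
  The undirected edge \<open>{u, v}\<close> is represented by the two arcs \<open>(u, v)\<close> and \<open>(v, u)\<close>, so the
  degree of a vertex is its out-degree.
\<close>

definition edges :: "'a pair_pre_digraph \<Rightarrow> 'a set set" where
  "edges G = {{u, v} |u v. (u, v) \<in> parcs G}"

definition bipartition :: "'a pair_pre_digraph \<Rightarrow> 'a set \<Rightarrow> 'a set \<Rightarrow> bool" where
  "bipartition G X Y \<longleftrightarrow> pverts G = X \<union> Y \<and> X \<inter> Y = {} \<and> parcs G \<subseteq> X \<times> Y \<union> Y \<times> X"

text \<open>Colors are attached to undirected edges, so both arcs of an edge have the same color.\<close>

definition edge_coloring :: "'a pair_pre_digraph \<Rightarrow> nat \<Rightarrow> ('a set \<Rightarrow> nat) \<Rightarrow> bool" where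
  "edge_coloring G t c \<longleftrightarrow> (\<forall>e\<in>edges G. c e < t)"

definition color_subgraph ::
    "'a pair_pre_digraph \<Rightarrow> ('a set \<Rightarrow> nat) \<Rightarrow> nat \<Rightarrow> 'a pair_pre_digraph" where
  "color_subgraph G c i =
     \<lparr>pverts = pverts G, parcs = {(u, v). (u, v) \<in> parcs G \<and> c {u, v} = i}\<rparr>"

text \<open>
  A connected component is a maximal connected subgraph. The qualifier selects graph
  connectedness rather than the topological notion of the same name.
\<close>

definition monochromatic_component ::
    "'a pair_pre_digraph \<Rightarrow> nat \<Rightarrow> ('a set \<Rightarrow> nat) \<Rightarrow> ('a, 'a \<times> 'a) pre_digraph \<Rightarrow> bool" where
  "monochromatic_component G t c H \<longleftrightarrow>
     (\<exists>i<t. pre_digraph.max_subgraph (with_proj (color_subgraph G c i))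
              Digraph_Component.connected H)"

end

theory Submission
  imports Defs
begin

text \<open>
  Suppose all monochromatic components have fewer than \<open>n/t\<close> vertices. Put \<open>r = 1/t\<close>, \<open>p = n\<^sub>1/n\<close>,
  \<open>q = n\<^sub>2/n\<close> and \<open>k = n\<^sub>1/n\<^sub>2\<close>. A component meeting \<open>X\<^sub>1\<close> and \<open>X\<^sub>2\<close> in fractions \<open>a\<close> and \<open>b\<close> then has
  relative size \<open>p a + q b < r\<close>; it is charged the deviation \<open>q a (b - r)\<^sup>2 + p b (a - r)\<^sup>2\<close> from the
  extremal shape \<open>a = b = r\<close>. Double counting shows that the deviations of all components add up to
  less than \<open>k r\<^sup>4\<close>, because the products \<open>a b\<close> add up to at least \<open>1 - \<gamma>\<close>.

  On the other hand each color has at least \<open>t + 1\<close> components. If all of them have size at least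
  \<open>r\<^sup>2/2\<close>, then they cannot all be close to the extremal shape, and the color contributes \<open>k r\<^sup>5\<close>. If
  this is so for all colors, the total is at least \<open>k r\<^sup>4\<close>. Otherwise some color has a component \<open>C\<close>
  smaller than \<open>r\<^sup>2/2\<close>. If \<open>b \<le> a\<close> for \<open>C\<close>, then a vertex of \<open>C\<close> in \<open>X\<^sub>1\<close> has few neighbors in that
  color, so its components in the other \<open>t - 1\<close> colors must cover almost all of \<open>X\<^sub>2\<close>. They have \<open>b\<close>
  larger than \<open>r\<close> on average, and together with \<open>C\<close> they already have total deviation at least
  \<open>k r\<^sup>4\<close>. The case \<open>a \<le> b\<close> is symmetric.
\<close>

section \<open>Lower bounds for the deviation of a single component\<close>

text \<open>The weights are crossed so that the cubic part factors as
  \<open>a * b * (p * a + q * b)\<close>, the product of the fractions times the size.\<close>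

definition deviation :: "real \<Rightarrow> real \<Rightarrow> real \<Rightarrow> real \<Rightarrow> real \<Rightarrow> real" where
  "deviation p q r a b = q * a * (b - r)\<^sup>2 + p * b * (a - r)\<^sup>2"

lemma deviation_swap: "deviation q p r b a = deviation p q r a b"
  by (simp add: deviation_def)

lemma deviation_nonneg:
  assumes "0 \<le> p" "0 \<le> q" "0 \<le> a" "0 \<le> b"
  shows "0 \<le> deviation p q r a b"
  using assms by (simp add: deviation_def)

text \<open>With \<open>s\<close> for the size, the deviation splits into
  \<open>(q * a + p * b) * (r - s)\<^sup>2\<close>, where the first factor is at least
  \<open>k * s\<close>, and a multiple of \<open>(a - b)\<^sup>2\<close> that is nonnegative since
  \<open>s \<le> r\<close>.\<close>

lemma deviation_ge_size:
  assumes "p + q = 1" "0 \<le> p" "0 \<le> q" "k * p \<le> q" "k * q \<le> p"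
    and "0 \<le> a" "0 \<le> b" "0 \<le> r" "p * a + q * b \<le> r"
  shows "k * ((p * a + q * b) * (r - (p * a + q * b))\<^sup>2) \<le> deviation p q r a b"
proof -
  define s where "s = p * a + q * b"
  have q: "q = 1 - p" using assms(1) by simp
  have eq: "deviation p q r a b = (q * a + p * b) * (r - s)\<^sup>2 + p * q * (a - b)\<^sup>2 * (2 * r - s)"
    unfolding deviation_def s_def q by algebra
  have "k * s \<le> q * a + p * b"
    using mult_right_mono[OF assms(4) assms(6)] mult_right_mono[OF assms(5) assms(7)]
    by (simp add: s_def algebra_simps)
  then have "k * s * (r - s)\<^sup>2 \<le> (q * a + p * b) * (r - s)\<^sup>2"
    by (intro mult_right_mono) auto
  moreover have "0 \<le> p * q * (a - b)\<^sup>2 * (2 * r - s)"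
    using assms by (intro mult_nonneg_nonneg) (auto simp: s_def)
  ultimately show ?thesis unfolding eq s_def[symmetric] by (simp add: mult.assoc)
qed

text \<open>Multiplied by \<open>p\<close> and written in the excess \<open>u\<close> and the slack
  \<open>w\<close>, the deviation loses its \<open>u ^ 3\<close> terms and only nonnegative terms
  remain; \<open>q * r * u\<^sup>2\<close> is the one kept.\<close>

lemma deviation_ge_large:
  assumes "p + q = 1" "0 < p" "0 \<le> q" "k * p \<le> q"
    and "0 \<le> r" "r \<le> b" "p * a + q * b \<le> r"
  shows "k * r * (b - r)\<^sup>2 \<le> deviation p q r a b"
proof -
  define u where "u = b - r"
  define w where "w = r - (p * a + q * b)"
  have q: "q = 1 - p" using assms(1) by simp
  have nn: "0 \<le> u" "0 \<le> w" using assms by (auto simp: u_def w_def)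
  have "p * deviation p q r a b = q * r * u\<^sup>2 + (q * u\<^sup>2 * w + u * w\<^sup>2 + r * (2 * q * u * w + w\<^sup>2))"
    unfolding deviation_def u_def w_def q by algebra
  moreover have "k * p * (r * u\<^sup>2) \<le> q * r * u\<^sup>2"
    using mult_right_mono[OF assms(4), of "r * u\<^sup>2"] assms(5) by (simp add: mult.assoc)
  moreover have "0 \<le> q * u\<^sup>2 * w + u * w\<^sup>2 + r * (2 * q * u * w + w\<^sup>2)"
    using nn assms by simp
  ultimately have "p * (k * r * u\<^sup>2) \<le> p * deviation p q r a b" by (simp add: algebra_simps)
  then show ?thesis using assms(2) by (simp add: u_def)
qed

text \<open>Replacing \<open>(b - r)\<^sup>2\<close> by its tangent at \<open>b = r + l\<close> makes the bound valid for \<open>b < r\<close> as well, and linear in \<open>b\<close>.\<close>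

lemma deviation_ge_tangent:
  assumes "p + q = 1" "0 < p" "0 \<le> q" "0 \<le> k" "k * p \<le> q"
    and "0 \<le> r" "0 \<le> a" "0 \<le> b" "p * a + q * b \<le> r" "0 \<le> l"
  shows "k * r * (2 * l * (b - r) - l\<^sup>2) \<le> deviation p q r a b"
proof (cases "r \<le> b")
  case True
  have "2 * l * (b - r) - l\<^sup>2 \<le> (b - r)\<^sup>2"
    using zero_le_power2[of "b - r - l"] by (simp add: power2_eq_square algebra_simps)
  then have "k * r * (2 * l * (b - r) - l\<^sup>2) \<le> k * r * (b - r)\<^sup>2"
    using assms by (intro mult_left_mono) auto
  also have "\<dots> \<le> deviation p q r a b"
    using assms True by (intro deviation_ge_large) auto
  finally show ?thesis .
next
  case False
  then have "2 * l * (b - r) \<le> 0"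
    using assms by (intro mult_nonneg_nonpos) auto
  then have "2 * l * (b - r) - l\<^sup>2 \<le> 0"
    using zero_le_power2[of l] by linarith
  then have "k * r * (2 * l * (b - r) - l\<^sup>2) \<le> 0"
    using assms by (intro mult_nonneg_nonpos) auto
  also have "\<dots> \<le> deviation p q r a b" using assms by (intro deviation_nonneg) auto
  finally show ?thesis .
qed

section \<open>Polynomial inequalities for medium and small sizes\<close>

text \<open>One component in this range already supplies the share of its color. With
  \<open>s = c * r\<^sup>2\<close> the claim is \<open>r \<le> c * (1 - c * r)\<^sup>2\<close>; the
  worst case \<open>r = 1/3\<close> reads \<open>3 \<le> c * (3 - c)\<^sup>2\<close>.\<close>

lemma medium_size_bound:
  fixes r s :: real
  assumes "0 < r" "r \<le> 1/3" "r\<^sup>2 / 2 \<le> s" "s \<le> r\<^sup>2 * (1 + r)"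
  shows "r ^ 5 \<le> s * (r - s)\<^sup>2"
proof -
  define c where "c = s / r\<^sup>2"
  have s: "s = c * r\<^sup>2" using assms(1) by (simp add: c_def)
  have c1: "1/2 \<le> c" and "c \<le> 1 + r"
    using assms by (auto simp: c_def field_simps)
  then have c2: "c \<le> 4/3" using assms(2) by simp
  have cubic: "3 \<le> c * (3 - c)\<^sup>2"
  proof -
    \<comment> \<open>The roots \<open>1/2\<close> and \<open>4/3\<close> bound the range of
      \<open>c\<close>; \<open>25/6\<close> makes the quadratic coefficients agree, so the remainder
      is linear.\<close>
    have "0 \<le> (c - 1/2) * (4/3 - c) * (25/6 - c)"
      using c1 c2 by simp
    moreover have "c * (3 - c)\<^sup>2 - 3 = (c - 1/2) * (4/3 - c) * (25/6 - c) + (25/36 * c - 2/9)"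
      by (simp add: power2_eq_square field_simps)
    ultimately show ?thesis using c1 by linarith
  qed
  have "r * 3 \<le> r * (c * (3 - c)\<^sup>2)"
    using cubic assms(1) by (intro mult_left_mono) auto
  also have "\<dots> = 3 * r * (3 * (c * (1 - c / 3)\<^sup>2))"
    by (simp add: power2_eq_square field_simps)
  also have "\<dots> \<le> 1 * (3 * (c * (1 - c * r)\<^sup>2))"
  proof (intro mult_mono mult_left_mono power_mono)
    show "1 - c / 3 \<le> 1 - c * r" using mult_left_mono[OF assms(2), of c] c1 by simp
  qed (use assms c1 c2 in auto)
  finally have "r \<le> c * (1 - c * r)\<^sup>2" by simp
  then have "r ^ 4 * r \<le> r ^ 4 * (c * (1 - c * r)\<^sup>2)"
    using assms(1) by (intro mult_left_mono) auto
  also have "\<dots> = s * (r - s)\<^sup>2"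
    unfolding s by algebra
  finally show ?thesis by (simp add: eval_nat_numeral)
qed

text \<open>Here \<open>m\<close> is the size of the small component: the second term comes from its
  own deviation, the first from the components through one of its vertices in the other colors.
  Divided by \<open>r ^ 4\<close>, the second is at least \<open>2 / 3 * c\<close>, and
  \<open>key\<close> supplies the rest.\<close>

lemma small_size_bound:
  fixes r m :: real
  assumes "0 < r" "r \<le> 1/3" "0 \<le> m" "m \<le> r\<^sup>2 / 2"
  shows "r ^ 4 \<le> r\<^sup>2 * (r - r ^ 3 - m)\<^sup>2 / (1 - r) + m * (r - m)\<^sup>2"
proof -
  define c where "c = m / r\<^sup>2"
  have m: "m = c * r\<^sup>2" using assms(1) by (simp add: c_def)
  have c: "0 \<le> c" "c \<le> 1/2"
    using assms by (auto simp: c_def field_simps)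
  have cr: "c * r \<le> 1/6" using mult_mono[OF c(2) assms(2)] assms c by simp
  have r2: "r\<^sup>2 \<le> r / 3" using mult_left_mono[OF assms(2), of r] assms(1) by (simp add: power2_eq_square)
  have key: "(1 - r) * (1 - 2 / 3 * c) \<le> (1 - r\<^sup>2 - c * r)\<^sup>2"
  proof -
    \<comment> \<open>The difference in \<open>key\<close> is
      \<open>A + B * c + (c * r)\<^sup>2\<close>; its linear part is interpolated between
      \<open>c = 0\<close> and \<open>c = 1/2\<close>.\<close>
    define A where "A = r - 2 * r\<^sup>2 + r ^ 4"
    define B where "B = 2 / 3 * (1 - r) - 2 * r + 2 * r ^ 3"
    have "(1 - r\<^sup>2 - c * r)\<^sup>2 - (1 - r) * (1 - 2 / 3 * c) = (1 - 2 * c) * A + 2 * c * (A + B / 2) + (c * r)\<^sup>2"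
      unfolding A_def B_def by algebra
    moreover have "0 \<le> A" unfolding A_def using r2 assms(1) zero_le_power[of r 4] by linarith
    moreover have "0 \<le> A + B / 2"
    proof -
      have "A + B / 2 = 1/3 - r / 3 - 2 * r\<^sup>2 + (r ^ 4 + r ^ 3)"
        unfolding A_def B_def by (simp add: field_simps)
      moreover have "0 \<le> r ^ 4 + r ^ 3" using assms(1) by simp
      ultimately show ?thesis using r2 assms(2) by linarith
    qed
    ultimately have "0 \<le> (1 - r\<^sup>2 - c * r)\<^sup>2 - (1 - r) * (1 - 2 / 3 * c)"
      using c by simp
    then show ?thesis by simp
  qed
  have "25 / 36 \<le> (1 - c * r)\<^sup>2"
    using power_mono[of "5/6" "1 - c * r" 2] cr by (simp add: power2_eq_square)
  then have two: "2 / 3 * c \<le> c * (1 - c * r)\<^sup>2"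
    using mult_left_mono[of "2/3" "(1 - c * r)\<^sup>2" c] c by (simp add: mult.commute)
  have "1 - 2 / 3 * c \<le> (1 - r\<^sup>2 - c * r)\<^sup>2 / (1 - r)"
    using key assms by (simp add: field_simps)
  then have "1 \<le> (1 - r\<^sup>2 - c * r)\<^sup>2 / (1 - r) + c * (1 - c * r)\<^sup>2"
    using two by linarith
  then have "r ^ 4 * 1 \<le> r ^ 4 * ((1 - r\<^sup>2 - c * r)\<^sup>2 / (1 - r) + c * (1 - c * r)\<^sup>2)"
    by (intro mult_left_mono) auto
  also have "\<dots> = (r ^ 4 * (1 - r\<^sup>2 - c * r)\<^sup>2) / (1 - r) + r ^ 4 * (c * (1 - c * r)\<^sup>2)"
    by (simp add: distrib_left)
  also have "r ^ 4 * (1 - r\<^sup>2 - c * r)\<^sup>2 = r\<^sup>2 * (r - r ^ 3 - m)\<^sup>2"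
    unfolding m by algebra
  also have "r ^ 4 * (c * (1 - c * r)\<^sup>2) = m * (r - m)\<^sup>2"
    unfolding m by algebra
  finally show ?thesis by simp
qed

section \<open>Total deviation in one color and in all colors\<close>

text \<open>A part of size at most \<open>r\<^sup>2 * (1 + r)\<close> suffices alone. Otherwise this
  threshold bounds the weights \<open>s C\<close> from below; times the sum of squares for
  \<open>t + 1\<close> equal parts it is exactly \<open>r ^ 5\<close>.\<close>

lemma sum_size_deviation_ge:
  fixes s :: "'b \<Rightarrow> real" and t :: nat
  assumes "3 \<le> t" and r: "r = 1 / real t" and fin: "finite P" and one: "(\<Sum>C\<in>P. s C) = 1"
    and up: "\<And>C. C \<in> P \<Longrightarrow> s C < r" and low: "\<And>C. C \<in> P \<Longrightarrow> r\<^sup>2 / 2 \<le> s C"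
  shows "r ^ 5 \<le> (\<Sum>C\<in>P. s C * (r - s C)\<^sup>2)"
proof (cases "\<exists>C\<in>P. s C \<le> r\<^sup>2 * (1 + r)")
  case True
  then obtain C where C: "C \<in> P" "s C \<le> r\<^sup>2 * (1 + r)" by blast
  have r0: "0 < r" "r \<le> 1/3" using assms(1) by (auto simp: r field_simps)
  have pos: "0 \<le> s C" if "C \<in> P" for C
    using low[OF that] zero_le_power2[of r] by linarith
  have "r ^ 5 \<le> s C * (r - s C)\<^sup>2"
    using C low r0 by (intro medium_size_bound) auto
  also have "\<dots> \<le> (\<Sum>C\<in>P. s C * (r - s C)\<^sup>2)"
    using C(1) fin pos by (intro member_le_sum) auto
  finally show ?thesis .
next
  case False
  have r0: "0 < r" "r \<le> 1/3" using assms(1) by (auto simp: r field_simps)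
  have "P \<noteq> {}" using one by auto
  then have "(\<Sum>C\<in>P. s C) < (\<Sum>C\<in>P. r)" using fin up by (intro sum_strict_mono) auto
  then have "real t < real (card P)" using one assms(1) by (simp add: r field_simps)
  then have N: "real t + 1 \<le> real (card P)" by simp
  \<comment> \<open>The value of \<open>r - s C\<close> when exactly \<open>t + 1\<close> parts have equal size.\<close>
  define l where "l = r / (real t + 1)"
  have tr: "real t * r = 1" using assms(1) by (simp add: r)
  have l0: "0 \<le> l" "l \<le> r" "(real t + 1) * l = r" using r0 assms(1)
    by (auto simp: l_def field_simps)
  have "r\<^sup>2 * (1 + r) * (r * l) = r\<^sup>2 * (1 + r) * (2 * l * ((real t + 1) * r - 1) - (real t + 1) * l\<^sup>2)"
    using tr l0(3) by algebra
  \<comment> \<open>The bound is affine in the number of parts with slope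
    \<open>l * (2 * r - l) \<ge> 0\<close>, so more than \<open>t + 1\<close> parts only increase
    it.\<close>
  also have "\<dots> = r\<^sup>2 * (1 + r) * ((real t + 1) * (l * (2 * r - l)) - 2 * l)"
    by algebra
  also have "\<dots> \<le> r\<^sup>2 * (1 + r) * (real (card P) * (l * (2 * r - l)) - 2 * l)"
    using N l0 r0 by (intro mult_left_mono diff_right_mono mult_right_mono) auto
  also have "real (card P) * (l * (2 * r - l)) - 2 * l = (\<Sum>C\<in>P. 2 * l * (r - s C) - l\<^sup>2)"
  proof -
    have "(\<Sum>C\<in>P. 2 * l * (r - s C) - l\<^sup>2) = (\<Sum>C\<in>P. l * (2 * r - l) - 2 * l * s C)"
      by (intro sum.cong refl) (simp add: power2_eq_square algebra_simps)
    then show ?thesis by (simp add: sum_subtractf one flip: sum_distrib_left)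
  qed
  also have "r\<^sup>2 * (1 + r) * \<dots> \<le> r\<^sup>2 * (1 + r) * (\<Sum>C\<in>P. (r - s C)\<^sup>2)"
  proof (intro mult_left_mono sum_mono)
    fix C show "2 * l * (r - s C) - l\<^sup>2 \<le> (r - s C)\<^sup>2"
      using zero_le_power2[of "r - s C - l"] by (simp add: power2_eq_square algebra_simps)
  qed (use r0 in auto)
  also have "\<dots> \<le> (\<Sum>C\<in>P. s C * (r - s C)\<^sup>2)"
    unfolding sum_distrib_left using False by (intro sum_mono mult_right_mono) (auto simp: not_le less_imp_le)
  finally have *: "r\<^sup>2 * (1 + r) * (r * l) \<le> (\<Sum>C\<in>P. s C * (r - s C)\<^sup>2)" .
  have "(1 + r) * l = r\<^sup>2"
    using tr l0(3) by algebra
  then have "r\<^sup>2 * (1 + r) * (r * l) = r ^ 5" by algebra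
  then show ?thesis using * by simp
qed

text \<open>When the squares are expanded, the terms linear in \<open>a\<close> and \<open>b\<close>
  add up to \<open>r\<^sup>2\<close> per color, hence to \<open>r\<close>; the bound
  \<open>up\<close> replaces the size in the cubic terms by \<open>r\<close>.\<close>

lemma sum_deviation_less:
  fixes P :: "nat \<Rightarrow> 'b set" and a b :: "'b \<Rightarrow> real" and t :: nat
  assumes "0 < t" and r: "r = 1 / real t" and pq: "p + q = 1"
    and fin: "\<And>i. i < t \<Longrightarrow> finite (P i)"
    and sa: "\<And>i. i < t \<Longrightarrow> (\<Sum>C\<in>P i. a C) = 1" and sb: "\<And>i. i < t \<Longrightarrow> (\<Sum>C\<in>P i. b C) = 1"
    and nn: "\<And>i C. i < t \<Longrightarrow> C \<in> P i \<Longrightarrow> 0 \<le> a C \<and> 0 \<le> b C"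
    and up: "\<And>i C. i < t \<Longrightarrow> C \<in> P i \<Longrightarrow> p * a C + q * b C < r"
    and D: "0 < (\<Sum>i<t. \<Sum>C\<in>P i. a C * b C)"
  shows "(\<Sum>i<t. \<Sum>C\<in>P i. deviation p q r (a C) (b C)) < r * (1 - (\<Sum>i<t. \<Sum>C\<in>P i. a C * b C))"
proof -
  let ?T = "Sigma {..<t} P"
  have finT: "finite ?T" using fin by auto
  have dev: "deviation p q r x y = x * y * (p * x + q * y) - 2 * r * (x * y) + (r\<^sup>2 * q * x + r\<^sup>2 * p * y)" for x y
    using pq unfolding deviation_def by algebra
  have inner: "(\<Sum>C\<in>P i. deviation p q r (a C) (b C)) =
     (\<Sum>C\<in>P i. a C * b C * (p * a C + q * b C)) - 2 * r * (\<Sum>C\<in>P i. a C * b C) + r\<^sup>2" if "i < t" for i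
  proof -
    have "r\<^sup>2 * q + r\<^sup>2 * p = r\<^sup>2" using pq by algebra
    then show ?thesis
      using sa[OF that] sb[OF that] by (simp add: dev sum.distrib sum_subtractf flip: sum_distrib_left)
  qed
  have D': "(\<Sum>i<t. \<Sum>C\<in>P i. a C * b C) = (\<Sum>(i, C)\<in>?T. a C * b C)"
    using fin by (subst sum.Sigma) auto
  \<comment> \<open>Strictness needs one component that meets both sides.\<close>
  have "\<exists>z\<in>?T. 0 < (case z of (i, C) \<Rightarrow> a C * b C)"
  proof (rule ccontr)
    assume "\<not> ?thesis"
    then have "(\<Sum>(i, C)\<in>?T. a C * b C) \<le> 0" by (intro sum_nonpos) (auto simp: not_less)
    then show False using D D' by simp
  qed
  then obtain i C where iC: "(i, C) \<in> ?T" "0 < a C * b C" by auto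
  have "(\<Sum>(i, C)\<in>?T. a C * b C * (p * a C + q * b C)) < (\<Sum>(i, C)\<in>?T. a C * b C * r)"
  proof (rule sum_strict_mono_ex1[OF finT])
    show "\<forall>z\<in>?T. (case z of (i, C) \<Rightarrow> a C * b C * (p * a C + q * b C)) \<le> (case z of (i, C) \<Rightarrow> a C * b C * r)"
    proof clarify
      fix i C assume "i < t" "C \<in> P i"
      then show "a C * b C * (p * a C + q * b C) \<le> a C * b C * r"
        using less_imp_le[OF up] nn by (intro mult_left_mono) auto
    qed
    show "\<exists>z\<in>?T. (case z of (i, C) \<Rightarrow> a C * b C * (p * a C + q * b C)) < (case z of (i, C) \<Rightarrow> a C * b C * r)"
      using iC(2) mult_strict_left_mono[OF up iC(2)] iC(1) by (intro bexI[of _ "(i, C)"]) auto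
  qed
  also have "\<dots> = r * (\<Sum>i<t. \<Sum>C\<in>P i. a C * b C)"
    unfolding D' by (simp add: sum_distrib_left case_prod_beta mult.commute)
  finally have *: "(\<Sum>i<t. \<Sum>C\<in>P i. a C * b C * (p * a C + q * b C)) < r * (\<Sum>i<t. \<Sum>C\<in>P i. a C * b C)"
    using fin by (subst sum.Sigma) auto
  have "(\<Sum>i<t. \<Sum>C\<in>P i. deviation p q r (a C) (b C)) =
     (\<Sum>i<t. \<Sum>C\<in>P i. a C * b C * (p * a C + q * b C)) - 2 * r * (\<Sum>i<t. \<Sum>C\<in>P i. a C * b C) + real t * r\<^sup>2"
    by (simp add: inner sum.distrib sum_subtractf flip: sum_distrib_left)
  also have "real t * r\<^sup>2 = r" using assms(1) by (simp add: r power2_eq_square)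
  finally show ?thesis using * by (simp add: algebra_simps)
qed

text \<open>\<open>K i\<close> stands for the component in color \<open>i\<close> through a fixed
  vertex of the small component \<open>K j\<close>. As \<open>b (K j)\<close> is at most the size of
  \<open>K j\<close>, \<open>deg\<close> forces the other \<open>b (K i)\<close> above
  \<open>r\<close> on average.\<close>

lemma sum_deviation_ge_small:
  fixes P :: "nat \<Rightarrow> 'b set" and a b :: "'b \<Rightarrow> real" and t :: nat
  assumes t: "3 \<le> t" and r: "r = 1 / real t"
    and pq: "p + q = 1" "0 < p" "0 < q" "0 \<le> k" "k * p \<le> q" "k * q \<le> p"
    and fin: "\<And>i. i < t \<Longrightarrow> finite (P i)"
    and nn: "\<And>i C. i < t \<Longrightarrow> C \<in> P i \<Longrightarrow> 0 \<le> a C \<and> 0 \<le> b C"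
    and up: "\<And>i C. i < t \<Longrightarrow> C \<in> P i \<Longrightarrow> p * a C + q * b C < r"
    and K: "\<And>i. i < t \<Longrightarrow> K i \<in> P i" and deg: "1 - r ^ 3 \<le> (\<Sum>i<t. b (K i))"
    and j: "j < t" "b (K j) \<le> a (K j)" "p * a (K j) + q * b (K j) \<le> r\<^sup>2 / 2"
  shows "k * r ^ 4 \<le> (\<Sum>i<t. \<Sum>C\<in>P i. deviation p q r (a C) (b C))"
proof -
  have r0: "0 < r" "r \<le> 1/3" using t by (auto simp: r field_simps)
  define m where "m = p * a (K j) + q * b (K j)"
  have nK: "0 \<le> a (K i)" "0 \<le> b (K i)" if "i < t" for i using nn[OF that K[OF that]] by auto
  have m0: "0 \<le> m" unfolding m_def using nK[OF j(1)] pq by simp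
  have "p * b (K j) + q * b (K j) \<le> m" unfolding m_def using j(2) pq by simp
  then have bm: "b (K j) \<le> m" using pq(1) by (simp flip: distrib_right)
  \<comment> \<open>This is what is left of \<open>1 - r ^ 3\<close> after deducting
    \<open>m\<close> for color \<open>j\<close> and \<open>r\<close> for each other color.\<close>
  define U where "U = r - r ^ 3 - m"
  have "r\<^sup>2 \<le> r / 3" "r ^ 3 \<le> r\<^sup>2" using r0 mult_left_mono[OF r0(2), of r] mult_left_mono[of r 1 "r\<^sup>2"]
    by (auto simp: power2_eq_square power3_eq_cube)
  then have U0: "0 \<le> U" using j(3) r0 unfolding U_def m_def by linarith
  \<comment> \<open>This is \<open>U / (t - 1)\<close>, the average excess of \<open>b\<close> over \<open>r\<close> in the colors other than \<open>j\<close>.\<close>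
  define l where "l = U * r / (1 - r)"
  have l0: "0 \<le> l" using U0 r0 by (simp add: l_def)
  let ?I = "{..<t} - {j}"
  let ?d = "\<lambda>C. deviation p q r (a C) (b C)"
  have card: "real (card ?I) = real t - 1" using j(1) by (simp add: card_Diff_singleton of_nat_diff)
  have tr: "real t * r = 1" using t by (simp add: r)
  have "(\<Sum>i<t. b (K i)) = b (K j) + (\<Sum>i\<in>?I. b (K i))"
    using j(1) by (intro sum.remove) auto
  then have "U \<le> (\<Sum>i\<in>?I. b (K i)) - (real t - 1) * r"
    using deg bm tr by (simp add: U_def algebra_simps)
  also have "\<dots> = (\<Sum>i\<in>?I. b (K i) - r)"
    unfolding sum_subtractf by (simp only: card sum_constant)
  finally have U: "U \<le> (\<Sum>i\<in>?I. b (K i) - r)" .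
  have lU: "(real t - 1) * l = U"
  proof -
    have "(real t - 1) * r = 1 - r" using tr by algebra
    then have "(real t - 1) * l = U * (1 - r) / (1 - r)"
      unfolding l_def by (metis mult.assoc mult.commute times_divide_eq_right)
    then show ?thesis using r0 by simp
  qed
  \<comment> \<open>This \<open>l\<close> maximizes \<open>2 * l * U - (t - 1) * l\<^sup>2\<close>,
    with value \<open>l * U\<close>.\<close>
  have "r\<^sup>2 * (r - r ^ 3 - m)\<^sup>2 / (1 - r) = r * (2 * l * U - (real t - 1) * l\<^sup>2)"
  proof -
    have "(real t - 1) * l\<^sup>2 = (real t - 1) * l * l" by (simp add: power2_eq_square)
    then have "r * (2 * l * U - (real t - 1) * l\<^sup>2) = r * (l * U)" by (simp add: lU)
    then show ?thesis by (simp add: l_def U_def power2_eq_square)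
  qed
  also have "\<dots> \<le> r * (2 * l * (\<Sum>i\<in>?I. b (K i) - r) - (real t - 1) * l\<^sup>2)"
    using U l0 r0 by (intro mult_left_mono diff_right_mono) auto
  also have "\<dots> = (\<Sum>i\<in>?I. r * (2 * l * (b (K i) - r) - l\<^sup>2))"
    unfolding sum_distrib_left[symmetric] sum_subtractf[of "\<lambda>i. 2 * l * (b (K i) - r)"]
    by (simp only: card sum_constant)
  finally have "k * (r\<^sup>2 * (r - r ^ 3 - m)\<^sup>2 / (1 - r)) \<le> k * \<dots>"
    using pq by (intro mult_left_mono)
  also have "\<dots> = (\<Sum>i\<in>?I. k * r * (2 * l * (b (K i) - r) - l\<^sup>2))"
    by (simp add: sum_distrib_left mult.assoc)
  also have "\<dots> \<le> (\<Sum>i\<in>?I. ?d (K i))"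
  proof (intro sum_mono)
    fix i assume "i \<in> ?I"
    then have i: "i < t" by simp
    show "k * r * (2 * l * (b (K i) - r) - l\<^sup>2) \<le> ?d (K i)"
      using pq r0 l0 nK[OF i] up[OF i K[OF i]] by (intro deviation_ge_tangent) auto
  qed
  finally have 1: "k * (r\<^sup>2 * (r - r ^ 3 - m)\<^sup>2 / (1 - r)) \<le> (\<Sum>i\<in>?I. ?d (K i))" .
  have 2: "k * (m * (r - m)\<^sup>2) \<le> ?d (K j)"
    unfolding m_def using pq r0 nK[OF j(1)] up[OF j(1) K[OF j(1)]] by (intro deviation_ge_size) auto
  have "k * r ^ 4 \<le> k * (r\<^sup>2 * (r - r ^ 3 - m)\<^sup>2 / (1 - r) + m * (r - m)\<^sup>2)"
    using r0 m0 j(3) pq unfolding m_def by (intro mult_left_mono small_size_bound) auto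
  also have "\<dots> \<le> ?d (K j) + (\<Sum>i\<in>?I. ?d (K i))" using 1 2 by (simp add: distrib_left)
  also have "\<dots> = (\<Sum>i<t. ?d (K i))" using j(1) by (intro sum.remove[symmetric]) auto
  also have "\<dots> \<le> (\<Sum>i<t. \<Sum>C\<in>P i. ?d C)"
  proof (intro sum_mono member_le_sum)
    fix i C assume "i \<in> {..<t}" "C \<in> P i - {K i}"
    then show "0 \<le> ?d C" using nn[of i C] pq by (intro deviation_nonneg) auto
  qed (use K fin in auto)
  finally show ?thesis .
qed

lemma sum_deviation_ge_large:
  fixes P :: "nat \<Rightarrow> 'b set" and a b :: "'b \<Rightarrow> real" and t :: nat
  assumes t: "3 \<le> t" and r: "r = 1 / real t"
    and pq: "p + q = 1" "0 \<le> p" "0 \<le> q" "0 \<le> k" "k * p \<le> q" "k * q \<le> p"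
    and fin: "\<And>i. i < t \<Longrightarrow> finite (P i)"
    and sa: "\<And>i. i < t \<Longrightarrow> (\<Sum>C\<in>P i. a C) = 1" and sb: "\<And>i. i < t \<Longrightarrow> (\<Sum>C\<in>P i. b C) = 1"
    and nn: "\<And>i C. i < t \<Longrightarrow> C \<in> P i \<Longrightarrow> 0 \<le> a C \<and> 0 \<le> b C"
    and up: "\<And>i C. i < t \<Longrightarrow> C \<in> P i \<Longrightarrow> p * a C + q * b C < r"
    and low: "\<And>i C. i < t \<Longrightarrow> C \<in> P i \<Longrightarrow> r\<^sup>2 / 2 \<le> p * a C + q * b C"
  shows "k * r ^ 4 \<le> (\<Sum>i<t. \<Sum>C\<in>P i. deviation p q r (a C) (b C))"
proof -
  have "real t * r = 1" using t by (simp add: r)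
  then have "k * r ^ 4 = real t * (k * r ^ 5)" by algebra
  also have "\<dots> = (\<Sum>i<t. k * r ^ 5)" by simp
  also have "\<dots> \<le> (\<Sum>i<t. \<Sum>C\<in>P i. deviation p q r (a C) (b C))"
  proof (rule sum_mono)
    fix i assume "i \<in> {..<t}"
    then have i: "i < t" by simp
    have "(\<Sum>C\<in>P i. p * a C + q * b C) = 1"
      using sa[OF i] sb[OF i] pq(1) by (simp add: sum.distrib flip: sum_distrib_left)
    then have "k * r ^ 5 \<le> k * (\<Sum>C\<in>P i. (p * a C + q * b C) * (r - (p * a C + q * b C))\<^sup>2)"
      using i fin up low pq by (intro mult_left_mono sum_size_deviation_ge[OF t r]) auto
    also have "\<dots> \<le> (\<Sum>C\<in>P i. deviation p q r (a C) (b C))"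
      unfolding sum_distrib_left
    proof (rule sum_mono)
      fix C assume C: "C \<in> P i"
      have "0 \<le> r" by (simp add: r)
      then show "k * ((p * a C + q * b C) * (r - (p * a C + q * b C))\<^sup>2) \<le> deviation p q r (a C) (b C)"
        using pq nn[OF i C] up[OF i C] by (intro deviation_ge_size) auto
    qed
    finally show "k * r ^ 5 \<le> (\<Sum>C\<in>P i. deviation p q r (a C) (b C))" .
  qed
  finally show ?thesis .
qed

section \<open>Double counting over partitions into classes\<close>

text \<open>By \<open>self\<close> and \<open>eq\<close> the sets \<open>K v\<close> partition
  \<open>V\<close>, so the elements of \<open>Z\<close> with class \<open>C\<close> are exactly
  \<open>C \<inter> Z\<close>.\<close>

lemma sum_over_classes:
  fixes h :: "'a set \<Rightarrow> real"
  assumes "finite V" "Z \<subseteq> V" and self: "\<And>v. v \<in> V \<Longrightarrow> v \<in> K v"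
    and eq: "\<And>v w. v \<in> V \<Longrightarrow> w \<in> K v \<Longrightarrow> K w = K v"
  shows "(\<Sum>z\<in>Z. h (K z)) = (\<Sum>C\<in>K ` V. real (card (C \<inter> Z)) * h C)"
proof -
  have "(\<Sum>z\<in>Z. h (K z)) = (\<Sum>C\<in>K ` V. \<Sum>z\<in>{z \<in> Z. K z = C}. h (K z))"
    using assms(1,2) by (intro sum.group[symmetric]) (auto intro: finite_subset)
  also have "\<dots> = (\<Sum>C\<in>K ` V. real (card (C \<inter> Z)) * h C)"
  proof (intro sum.cong refl)
    fix C assume "C \<in> K ` V"
    then obtain v where v: "v \<in> V" "C = K v" by blast
    have "{z \<in> Z. K z = C} = C \<inter> Z"
      unfolding v(2) using assms(2) self eq[OF v(1)] by blast
    then show "(\<Sum>z\<in>{z \<in> Z. K z = C}. h (K z)) = real (card (C \<inter> Z)) * h C"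
      by (subst sum.cong[OF refl, where h = "\<lambda>_. h C"]) auto
  qed
  finally show ?thesis .
qed

text \<open>A graph-free form of the theorem: components enter only as partition classes, and
  degrees only through the part of each class on the opposite side.\<close>

lemma exists_large_class:
  fixes K :: "nat \<Rightarrow> 'a \<Rightarrow> 'a set" and X Y :: "'a set" and t :: nat and \<gamma> :: real
  assumes t: "3 \<le> t" and fin: "finite X" "finite Y" and disj: "X \<inter> Y = {}"
    and X: "X \<noteq> {}" and XY: "card X \<le> card Y"
    and \<gamma>: "\<gamma> \<le> (real (card X) / real (card Y)) / real t ^ 3"
    and sub: "\<And>i v. i < t \<Longrightarrow> v \<in> X \<union> Y \<Longrightarrow> K i v \<subseteq> X \<union> Y"
    and self: "\<And>i v. i < t \<Longrightarrow> v \<in> X \<union> Y \<Longrightarrow> v \<in> K i v"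
    and eq: "\<And>i v w. i < t \<Longrightarrow> v \<in> X \<union> Y \<Longrightarrow> w \<in> K i v \<Longrightarrow> K i w = K i v"
    and degX: "\<And>x. x \<in> X \<Longrightarrow> (1 - \<gamma>) * real (card Y) \<le> (\<Sum>i<t. real (card (K i x \<inter> Y)))"
    and degY: "\<And>y. y \<in> Y \<Longrightarrow> (1 - \<gamma>) * real (card X) \<le> (\<Sum>i<t. real (card (K i y \<inter> X)))"
  shows "\<exists>i<t. \<exists>v\<in>X \<union> Y. real (card (X \<union> Y)) / real t \<le> real (card (K i v))"
proof (rule ccontr)
  assume "\<not> ?thesis"
  then have small: "real (card (K i v)) < real (card (X \<union> Y)) / real t" if "i < t" "v \<in> X \<union> Y" for i v
    using that by (meson not_le)
  define n1 n2 n where "n1 = real (card X)" and "n2 = real (card Y)" and "n = n1 + n2"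
  define r p q k where "r = 1 / real t" and "p = n1 / n" and "q = n2 / n" and "k = n1 / n2"
  define P where "P = (\<lambda>i. K i ` (X \<union> Y))"
  define a where "a = (\<lambda>C. real (card (C \<inter> X)) / n1)"
  define b where "b = (\<lambda>C. real (card (C \<inter> Y)) / n2)"
  have n: "0 < n1" "n1 \<le> n2"
    using X XY fin by (auto simp: n1_def n2_def card_gt_0_iff)
  then have n': "0 < n2" "0 < n" by (auto simp: n_def)
  have cardXY: "real (card (X \<union> Y)) = n"
    using fin disj by (simp add: card_Un_disjoint n_def n1_def n2_def)
  have pq: "p + q = 1" "0 < p" "0 < q" "0 \<le> k" "k * p \<le> q" "k * q \<le> p"
  proof -
    show "k * p \<le> q"
      using n n' mult_mono[OF n(2) n(2)] by (simp add: k_def p_def q_def field_simps)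
    show "p + q = 1"
      using n' by (simp add: p_def q_def n_def flip: add_divide_distrib)
  qed (use n n' in \<open>auto simp: p_def q_def k_def\<close>)
  have g: "\<gamma> \<le> k * r ^ 3" using \<gamma> by (simp add: k_def r_def n1_def n2_def power_divide)
  have r0: "0 < r" "r \<le> 1 / 3" using t by (auto simp: r_def field_simps)
  \<comment> \<open>Since \<open>k \<le> 1\<close>, the loss in the degrees is at most
    \<open>r ^ 3\<close>; \<open>\<gamma> < 1\<close> makes the sum of products positive.\<close>
  have "r ^ 3 \<le> 1 / 27" using power_mono[OF r0(2), of 3] r0 by (simp add: power3_eq_cube)
  moreover have "k * r ^ 3 \<le> 1 * r ^ 3"
    using n r0 by (intro mult_right_mono) (auto simp: k_def)
  ultimately have g1: "\<gamma> \<le> r ^ 3" "\<gamma> < 1" using g by auto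
  have finP: "finite (P i)" for i using fin by (simp add: P_def)
  have nn: "0 \<le> a C \<and> 0 \<le> b C" for C using n n' by (simp add: a_def b_def)
  have size: "p * a C + q * b C = real (card C) / n" if "i < t" "C \<in> P i" for i C
  proof -
    have "C \<subseteq> X \<union> Y" using that sub by (auto simp: P_def)
    then have "C = (C \<inter> X) \<union> (C \<inter> Y)" by auto
    then have "card C = card (C \<inter> X) + card (C \<inter> Y)"
      using fin disj by (metis card_Un_disjoint finite_Int inf_assoc inf_commute inf_bot_right)
    then show ?thesis using n n' by (simp add: p_def q_def a_def b_def field_simps)
  qed
  have up: "p * a C + q * b C < r" if "i < t" "C \<in> P i" for i C
    using small that n' unfolding size[OF that] cardXY by (auto simp: P_def r_def field_simps)
  have over: "(\<Sum>z\<in>Z. h (K i z)) = (\<Sum>C\<in>P i. real (card (C \<inter> Z)) * h C)"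
    if "i < t" "Z \<subseteq> X \<union> Y" for i Z and h :: "'a set \<Rightarrow> real"
    unfolding P_def
    by (rule sum_over_classes[OF finite_UnI[OF fin] that(2) self[OF that(1)] eq[OF that(1)]])
  have sa: "(\<Sum>C\<in>P i. a C) = 1" and sb: "(\<Sum>C\<in>P i. b C) = 1" if "i < t" for i
    using over[OF that, of X "\<lambda>_. 1"] over[OF that, of Y "\<lambda>_. 1"] n n'
    by (auto simp: a_def b_def n1_def n2_def simp flip: sum_divide_distrib)
  have dx: "1 - \<gamma> \<le> (\<Sum>i<t. b (K i x))" if "x \<in> X" for x
    using degX[OF that] n' by (simp add: b_def pos_le_divide_eq n2_def flip: sum_divide_distrib)
  have dy: "1 - \<gamma> \<le> (\<Sum>i<t. a (K i y))" if "y \<in> Y" for y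
    using degY[OF that] n by (simp add: a_def pos_le_divide_eq n1_def flip: sum_divide_distrib)
  \<comment> \<open>Average \<open>dx\<close> over \<open>X\<close>: a class \<open>C\<close> is
    counted for the fraction \<open>a C\<close> of the vertices.\<close>
  have D: "1 - \<gamma> \<le> (\<Sum>i<t. \<Sum>C\<in>P i. a C * b C)"
  proof -
    have "n1 * (1 - \<gamma>) = (\<Sum>x\<in>X. 1 - \<gamma>)" by (simp add: n1_def)
    also have "\<dots> \<le> (\<Sum>x\<in>X. \<Sum>i<t. b (K i x))" using dx by (intro sum_mono)
    also have "\<dots> = (\<Sum>i<t. \<Sum>x\<in>X. b (K i x))" by (rule sum.swap)
    also have "\<dots> = (\<Sum>i<t. \<Sum>C\<in>P i. real (card (C \<inter> X)) * b C)"
      using over by (intro sum.cong refl) auto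
    also have "\<dots> = n1 * (\<Sum>i<t. \<Sum>C\<in>P i. a C * b C)"
      using n by (simp add: a_def sum_distrib_left)
    finally show ?thesis using n by simp
  qed
  have "(\<Sum>i<t. \<Sum>C\<in>P i. deviation p q r (a C) (b C)) < r * (1 - (\<Sum>i<t. \<Sum>C\<in>P i. a C * b C))"
    using t pq finP sa sb nn up D g1 by (intro sum_deviation_less) (auto simp: r_def)
  also have "\<dots> \<le> r * (k * r ^ 3)" using D g r0 by (intro mult_left_mono) auto
  finally have upper: "(\<Sum>i<t. \<Sum>C\<in>P i. deviation p q r (a C) (b C)) < k * r ^ 4"
    by (simp add: eval_nat_numeral algebra_simps)
  show False
  proof (cases "\<forall>i<t. \<forall>C\<in>P i. r\<^sup>2 / 2 \<le> p * a C + q * b C")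
    case True
    have "k * r ^ 4 \<le> (\<Sum>i<t. \<Sum>C\<in>P i. deviation p q r (a C) (b C))"
      by (rule sum_deviation_ge_large[OF t r_def]) (use pq finP sa sb nn up True in auto)
    then show False using upper by simp
  next
    case False
    then obtain j C where j: "j < t" and C: "C \<in> P j" and Cs: "p * a C + q * b C \<le> r\<^sup>2 / 2"
      by (meson less_imp_le not_le)
    have KC: "K j v = C" if "v \<in> C" for v
    proof -
      obtain u where u: "u \<in> X \<union> Y" "C = K j u" using C by (auto simp: P_def)
      show ?thesis using eq[OF j u(1), of v] that by (simp add: u(2))
    qed
    have CV: "C \<noteq> {}" "C \<subseteq> X \<union> Y" using C self[OF j] sub[OF j] unfolding P_def by blast+
    then have "0 < card C" using fin by (meson card_gt_0_iff finite_UnI finite_subset)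
    then have pos: "0 < p * a C + q * b C" using n' by (simp add: size[OF j C])
    consider "b C \<le> a C" | "a C \<le> b C" by linarith
    then show False
    proof cases
      case 1
      have "a C \<noteq> 0" using pos 1 pq nn[of C] by auto
      then have "C \<inter> X \<noteq> {}" unfolding a_def by force
      then obtain x where x: "x \<in> C" "x \<in> X" by blast
      have "k * r ^ 4 \<le> (\<Sum>i<t. \<Sum>C\<in>P i. deviation p q r (a C) (b C))"
      proof (rule sum_deviation_ge_small[OF t r_def, where K = "\<lambda>i. K i x" and j = j])
        show "1 - r ^ 3 \<le> (\<Sum>i<t. b (K i x))" using dx[OF x(2)] g1 by simp
      qed (use pq finP nn up x j 1 Cs in \<open>auto simp: KC P_def\<close>)
      then show False using upper by simp
    next
      case 2
      have "b C \<noteq> 0" using pos 2 pq nn[of C] by auto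
      then have "C \<inter> Y \<noteq> {}" unfolding b_def by force
      then obtain y where y: "y \<in> C" "y \<in> Y" by blast
      \<comment> \<open>The conditions on \<open>p\<close>, \<open>q\<close> and \<open>k\<close>
        are symmetric, so the same lemma applies with the sides exchanged.\<close>
      have "k * r ^ 4 \<le> (\<Sum>i<t. \<Sum>C\<in>P i. deviation q p r (b C) (a C))"
      proof (rule sum_deviation_ge_small[OF t r_def, where K = "\<lambda>i. K i y" and j = j])
        show "1 - r ^ 3 \<le> (\<Sum>i<t. a (K i y))" using dy[OF y(2)] g1 by simp
      qed (use pq finP nn up y j 2 Cs in \<open>auto simp: KC P_def add.commute\<close>)
      then show False using upper by (simp add: deviation_swap)
    qed
  qed
qed

section \<open>Reachability classes as monochromatic components\<close>

text \<open>Connectedness is defined through the symmetric closure, which adds no reachability here;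
  a larger connected subgraph therefore cannot leave the class of \<open>u\<close>.\<close>

lemma (in sym_digraph) max_subgraph_connected_reachable:
  assumes "u \<in> verts G"
  shows "max_subgraph connected (G \<restriction> {v. u \<rightarrow>\<^sup>* v})"
proof (rule max_subgraphI)
  let ?R = "{v. u \<rightarrow>\<^sup>* v}"
  have scc: "G \<restriction> ?R \<in> sccs" using assms by (rule induce_reachable_is_in_sccs)
  then show sub: "subgraph (G \<restriction> ?R) G" by (auto intro: induced_imp_subgraph)
  interpret H: wf_digraph "G \<restriction> ?R" by (rule wellformed_induce_subgraph)
  show "connected (G \<restriction> ?R)"
    using scc by (auto simp: sccs_def connected_def strongly_connected_def intro: H.reachable_mk_symmetricI)
  fix H' assume H': "G \<restriction> ?R \<noteq> H'" "subgraph (G \<restriction> ?R) H'" "subgraph H' G"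
  show "\<not> connected H'"
  proof
    assume conn: "connected H'"
    have "u \<in> verts H'" using subgraph_imp_subverts[OF H'(2)] assms by auto
    interpret S: pair_wf_digraph "mk_symmetric G" ..
    have "verts H' \<subseteq> ?R"
    proof
      fix v assume "v \<in> verts H'"
      then have "u \<rightarrow>\<^sup>*\<^bsub>mk_symmetric H'\<^esub> v"
        using conn \<open>u \<in> verts H'\<close> by (auto simp: connected_def strongly_connected_def)
      then have "u \<rightarrow>\<^sup>*\<^bsub>mk_symmetric G\<^esub> v"
        using S.reachable_mono subgraph_mk_symmetric[OF H'(3)] by blast
      then show "v \<in> ?R" by (simp add: reachable_mk_symmetric_eq[OF sym_arcs])
    qed
    then have "verts H' = ?R" using subgraph_imp_subverts[OF H'(2)] by auto
    \<comment> \<open>The induced subgraph already has every arc of \<open>G\<close> with both ends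
      in \<open>?R\<close>.\<close>
    moreover from this have "arcs H' = arcs (G \<restriction> ?R)"
      using H'(2,3) by (auto simp: subgraph_def compatible_def wf_digraph_def)
    moreover have "tail H' = tail G" "head H' = head G"
      using H'(3) by (auto simp: subgraph_def compatible_def)
    ultimately show False using H'(1) by (simp add: induce_subgraph_def)
  qed
qed

lemma pair_sym_digraph_color_subgraph:
  assumes "pair_sym_digraph G"
  shows "pair_sym_digraph (color_subgraph G c i)"
proof -
  interpret pair_sym_digraph G by fact
  show ?thesis
    by unfold_locales
      (auto simp: color_subgraph_def symmetric_def insert_commute dest: wellformed' intro!: symI arcs_symmetric)
qed

theorem theorem1p3:
  fixes G :: "'a pair_pre_digraph"
    and X\<^sub>1 X\<^sub>2 :: "'a set"
    and t n\<^sub>1 n\<^sub>2 n :: nat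
    and \<gamma> :: real
    and c :: "'a set \<Rightarrow> nat"
  assumes "t \<ge> 3"
    and "n\<^sub>2 \<ge> n\<^sub>1" and "n\<^sub>1 \<ge> 1"
    and "n = n\<^sub>1 + n\<^sub>2"
    and "\<gamma> \<le> (real n\<^sub>1 / real n\<^sub>2) / real t ^ 3"
    and "pair_graph G"
    and "bipartition G X\<^sub>1 X\<^sub>2"
    and "card X\<^sub>1 = n\<^sub>1" and "card X\<^sub>2 = n\<^sub>2"
    and "\<forall>x\<in>X\<^sub>1. real (out_degree (with_proj G) x) \<ge> (1 - \<gamma>) * real n\<^sub>2"
    and "\<forall>y\<in>X\<^sub>2. real (out_degree (with_proj G) y) \<ge> (1 - \<gamma>) * real n\<^sub>1"
    and "edge_coloring G t c"
  shows "\<exists>H. monochromatic_component G t c H \<and> real (card (verts H)) \<ge> real n / real t"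
proof -
  interpret pair_graph G by fact
  define S where "S i = with_proj (color_subgraph G c i)" for i
  define K where "K i u = {v. u \<rightarrow>\<^sup>*\<^bsub>S i\<^esub> v}" for i u
  have sym: "sym_digraph (S i)" for i
  proof -
    interpret C: pair_sym_digraph "color_subgraph G c i"
      by (intro pair_sym_digraph_color_subgraph) unfold_locales
    show ?thesis unfolding S_def by unfold_locales
  qed
  have V: "verts (S i) = X\<^sub>1 \<union> X\<^sub>2" for i
    using assms(7) by (simp add: S_def color_subgraph_def bipartition_def)
  have bip: "pverts G = X\<^sub>1 \<union> X\<^sub>2" "X\<^sub>1 \<inter> X\<^sub>2 = {}" "parcs G \<subseteq> X\<^sub>1 \<times> X\<^sub>2 \<union> X\<^sub>2 \<times> X\<^sub>1"
    using assms(7) by (auto simp: bipartition_def)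
  have finX: "finite X\<^sub>1" "finite X\<^sub>2" using pair_finite_verts bip(1) by auto
  have Ksub: "K i v \<subseteq> X\<^sub>1 \<union> X\<^sub>2" if "v \<in> X\<^sub>1 \<union> X\<^sub>2" for i v
  proof -
    interpret C: sym_digraph "S i" by (rule sym)
    show ?thesis using C.reachable_in_verts V[of i] by (auto simp: K_def)
  qed
  have Kself: "v \<in> K i v" if "v \<in> X\<^sub>1 \<union> X\<^sub>2" for i v
  proof -
    interpret C: sym_digraph "S i" by (rule sym)
    show ?thesis using that V[of i] by (simp add: K_def)
  qed
  have Keq: "K i w = K i v" if "w \<in> K i v" for i v w
  proof -
    interpret C: sym_digraph "S i" by (rule sym)
    have vw: "v \<rightarrow>\<^sup>*\<^bsub>S i\<^esub> w" using that by (simp add: K_def)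
    then have wv: "w \<rightarrow>\<^sup>*\<^bsub>S i\<^esub> v" by (rule C.symmetric_reachable')
    show ?thesis unfolding K_def using vw wv by (auto intro: C.reachable_trans)
  qed
  \<comment> \<open>A neighbor of \<open>u\<close> lies on the other side, and in the class of
    \<open>u\<close> for the color of the joining edge.\<close>
  have deg: "real (out_degree (with_proj G) u) \<le> (\<Sum>i<t. real (card (K i u \<inter> B)))"
    if "(A = X\<^sub>1 \<and> B = X\<^sub>2) \<or> (A = X\<^sub>2 \<and> B = X\<^sub>1)" "u \<in> A" for A B u
  proof -
    have "snd ` out_arcs (with_proj G) u \<subseteq> (\<Union>i<t. K i u \<inter> B)"
    proof clarify
      fix e assume "e \<in> out_arcs (with_proj G) u"
      then obtain v where v: "e = (u, v)" "(u, v) \<in> parcs G" by (cases e) auto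
      interpret C: sym_digraph "S (c {u, v})" by (rule sym)
      have "c {u, v} < t" using assms(12) v(2) by (auto simp: edge_coloring_def edges_def)
      moreover have "v \<in> K (c {u, v}) u"
        using v(2) by (auto simp: K_def S_def color_subgraph_def intro: C.reachable_adjI[unfolded S_def color_subgraph_def])
      moreover have "v \<in> B" using v(2) bip that by blast
      ultimately show "snd e \<in> (\<Union>i<t. K i u \<inter> B)" using v(1) by auto
    qed
    moreover have "finite (\<Union>i<t. K i u \<inter> B)" using finX that by auto
    ultimately have "card (snd ` out_arcs (with_proj G) u) \<le> card (\<Union>i<t. K i u \<inter> B)"
      by (rule card_mono[rotated])
    also have "\<dots> \<le> (\<Sum>i<t. card (K i u \<inter> B))" by (rule card_UN_le) simp
    \<comment> \<open>Arcs out of \<open>u\<close> share their tail, so their heads determine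
      them.\<close>
    also have "card (snd ` out_arcs (with_proj G) u) = out_degree (with_proj G) u"
      unfolding out_degree_def by (intro card_image inj_onI) auto
    finally show ?thesis by (simp flip: of_nat_sum)
  qed
  have "\<exists>i<t. \<exists>v\<in>X\<^sub>1 \<union> X\<^sub>2. real (card (X\<^sub>1 \<union> X\<^sub>2)) / real t \<le> real (card (K i v))"
  proof (rule exists_large_class[where \<gamma> = \<gamma>])
    show "(1 - \<gamma>) * real (card X\<^sub>2) \<le> (\<Sum>i<t. real (card (K i x \<inter> X\<^sub>2)))" if "x \<in> X\<^sub>1" for x
      using deg[of X\<^sub>1 X\<^sub>2 x] that assms(9,10) by fastforce
    show "(1 - \<gamma>) * real (card X\<^sub>1) \<le> (\<Sum>i<t. real (card (K i y \<inter> X\<^sub>1)))" if "y \<in> X\<^sub>2" for y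
      using deg[of X\<^sub>2 X\<^sub>1 y] that assms(8,11) by fastforce
    show "X\<^sub>1 \<noteq> {}" using assms(3,8) by auto
  qed (use assms finX bip Ksub Kself Keq in auto)
  then obtain i v where iv: "i < t" "v \<in> X\<^sub>1 \<union> X\<^sub>2" "real (card (X\<^sub>1 \<union> X\<^sub>2)) / real t \<le> real (card (K i v))"
    by blast
  interpret C: sym_digraph "S i" by (rule sym)
  have "pre_digraph.max_subgraph (S i) Digraph_Component.connected (S i \<restriction> K i v)"
    unfolding K_def using iv(2) V by (intro C.max_subgraph_connected_reachable) auto
  then have "monochromatic_component G t c (S i \<restriction> K i v)"
    using iv(1) by (auto simp: monochromatic_component_def S_def)
  moreover have "card (X\<^sub>1 \<union> X\<^sub>2) = n"
    using finX bip(2) assms(4,8,9) by (simp add: card_Un_disjoint)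
  ultimately show ?thesis using iv(3) by (intro exI[of _ "S i \<restriction> K i v"]) simp
qed

end
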